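(* Let $q$ be a prime power and for $n\ge1$ let $\rho_q(n)=\frac{\varphi(q^n-1)}{q^n}$ be the density of primitive elements in $\mathbb{F}_{q^n}$. For each positive integer $t$, let $L_t$ be the least common multiple of the positive integers $i\le t$, and set $A_t=\frac{1}{L_t}\sum_{r\mid L_t}\rho_q(r)\varphi\!\left(\frac{L_t}{r}\right)$. Then $\{A_t\}_{t\ge1}$ converges to a limit $\overline{\rho}_q>0$, and $$\overline{\rho}_q=\lim_{x\to+\infty}\frac{1}{x}\sum_{n\le x}\rho_q(n).$$ Moreover, $\liminf_{q\to+\infty}\overline{\rho}_q=0$ (the liminf over prime powers $q$).
   Context: $\varphi$ is Euler's totient function. $\mathbb{F}_{q^n}$ is the degree-$n$ extension of the finite field $\mathbb{F}_q$; a primitive element is a generator of the cyclic group $\mathbb{F}_{q^n}^*$, and there are $\varphi(q^n-1)$ of them. *)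

theory Defs
  imports Complex_Main "HOL-Number_Theory.Number_Theory" "HOL-Library.Extended_Real"
begin

definition rho :: "nat \<Rightarrow> nat \<Rightarrow> real" where
  "rho q n = real (totient (q ^ n - 1)) / real (q ^ n)"

definition L :: "nat \<Rightarrow> nat" where
  "L t = Lcm {1..t}"

definition A :: "nat \<Rightarrow> nat \<Rightarrow> real" where
  "A q t = (1 / real (L t)) * (\<Sum>r | r dvd L t. rho q r * real (totient (L t div r)))"

text \<open>The value of \<open>lim\<close> is only meaningful when the sequence converges, so convergence has to be
  asserted separately wherever \<open>rho_bar\<close> is used. The index 0 of the sequence is irrelevant to the
  limit.\<close>

definition rho_bar :: "nat \<Rightarrow> real" where
  "rho_bar q = lim (A q)"

definition primepow_at_top :: "nat filter" where
  "primepow_at_top = inf at_top (principal {q. primepow q})"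

end

theory Submission
  imports Defs "HOL-Analysis.Harmonic_Numbers" "HOL-Analysis.Infinite_Products"
begin

text \<open>Up to a summable error, \<open>rho q n\<close> is the product of \<open>1 - 1 / p\<close> over the primes \<open>p\<close> whose order
  \<open>ord p q\<close> divides \<open>n\<close>. Let \<open>E k\<close> be the sum of \<open>1 / p\<close> over the primes of order \<open>k\<close>. These primes are
  \<open>1\<close> modulo \<open>k\<close> and number \<open>O(k)\<close>, so \<open>E k = O(k powr (-1/2))\<close> and the sum of \<open>E k / k\<close> converges.
  Replacing \<open>n\<close> by \<open>gcd n (L t)\<close> therefore changes the mean by at most the tail of this series beyond
  \<open>t\<close>. The modified function has period \<open>L t\<close>, hence has a mean, which is \<open>A q t\<close> up to a term killed by
  \<open>totient N / N \<le> 1 / harm y\<close> (valid when all \<open>d \<le> y\<close> divide \<open>N\<close>). Positivity comes from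
  \<open>1 - 1 / p \<ge> exp (- 2 / p)\<close> and Jensen's inequality, and for the lower limit one takes powers \<open>q\<close> of two
  such that \<open>q - 1\<close> is divisible by the odd part of \<open>L t\<close>.\<close>

section \<open>Totient density and means of periodic functions\<close>

definition totient_density :: "nat \<Rightarrow> real" where
  "totient_density n = real (totient n) / real n"

lemma totient_density_eq_prod:
  "n > 0 \<Longrightarrow> totient_density n = (\<Prod>p\<in>prime_factors n. 1 - 1 / real p)"
  by (simp add: totient_density_def totient_formula2)

lemma totient_density_nonneg: "0 \<le> totient_density n"
  by (simp add: totient_density_def)

lemma totient_density_le_1: "totient_density n \<le> 1"
  by (simp add: totient_density_def totient_le divide_le_eq)

text \<open>Passing from \<open>m\<close> to \<open>n\<close> multiplies the density by
  \<open>1 - 1 / p\<close> for each new prime \<open>p\<close>. The Weierstrass product inequality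
  bounds the loss by the sum of these \<open>1 / p\<close>.\<close>

lemma totient_density_decrease:
  assumes "m dvd n" "n > 0"
  shows "totient_density n \<le> totient_density m"
    and "totient_density m - totient_density n
           \<le> (\<Sum>p\<in>prime_factors n - prime_factors m. 1 / real p)"
proof -
  let ?D = "prime_factors n - prime_factors m"
  define c where "c = (\<Prod>p\<in>?D. 1 - 1 / real p)"
  have "m > 0" using assms by (auto intro: Nat.gr0I)
  have "prime_factors m \<subseteq> prime_factors n"
    using assms by (simp add: dvd_prime_factors)
  then have n: "totient_density n = c * totient_density m"
    using assms \<open>m > 0\<close>
    by (simp add: totient_density_eq_prod c_def prod.subset_diff[of "prime_factors m" "prime_factors n"])
  have p: "1 / real p \<le> 1" "0 \<le> 1 / real p" for p
    by (cases p; simp)+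
  have "c \<le> 1" unfolding c_def using p by (intro prod_le_1) auto
  then show "totient_density n \<le> totient_density m"
    unfolding n using totient_density_nonneg[of m] by (simp add: mult_left_le_one_le mult_le_cancel_right2)
  have "1 - c \<le> (\<Sum>p\<in>?D. 1 / real p)"
    using Weierstrass_prod_ineq[of ?D "\<lambda>p. 1 / real p"] p by (auto simp: c_def)
  moreover have "totient_density m - totient_density n \<le> 1 - c"
    using mult_left_le[OF totient_density_le_1[of m], of "1 - c"] \<open>c \<le> 1\<close>
    by (simp add: n left_diff_distrib)
  ultimately show "totient_density m - totient_density n \<le> (\<Sum>p\<in>?D. 1 / real p)" by linarith
qed

text \<open>Grouping \<open>m\<close> by its gcd with \<open>N\<close> shows that a divisor sum of
  the shape used in \<open>A\<close> is the sum of a function of the gcd over one full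
  period.\<close>

lemma sum_gcd_eq:
  fixes g :: "nat \<Rightarrow> real"
  assumes "N > 0"
  shows "(\<Sum>m\<in>{1..N}. g (gcd m N)) = (\<Sum>d | d dvd N. g d * real (totient (N div d)))"
proof -
  have "(\<Sum>m\<in>{1..N}. g (gcd m N)) = (\<Sum>d | d dvd N. \<Sum>m\<in>{m\<in>{1..N}. gcd m N = d}. g (gcd m N))"
    using assms by (intro sum.group[symmetric]) auto
  also have "\<dots> = (\<Sum>d | d dvd N. g d * real (totient (N div d)))"
  proof (intro sum.cong refl)
    fix d assume "d \<in> {d. d dvd N}"
    then have "card {m\<in>{1..N}. gcd m N = d} = totient (N div d)"
      using card_gcd_eq_totient[of N d] assms by (simp add: atLeastSucAtMost_greaterThanAtMost)
    then show "(\<Sum>m\<in>{m\<in>{1..N}. gcd m N = d}. g (gcd m N)) = g d * real (totient (N div d))"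
      by simp
  qed
  finally show ?thesis .
qed

lemma sum_totient_codivisors:
  "n > 0 \<Longrightarrow> (\<Sum>d | d dvd n. real (totient (n div d))) = real n"
  using sum_gcd_eq[of n "\<lambda>_. 1"] by simp

text \<open>In Gauss's identity for \<open>N\<close>, every divisor \<open>d\<close> contributes
  \<open>totient (N div d)\<close>, which is at least \<open>totient N / d\<close>. The divisors up
  to \<open>y\<close> alone give \<open>totient N * harm y\<close>.\<close>

lemma totient_density_le_inverse_harm:
  assumes "N > 0" "\<And>d. 1 \<le> d \<Longrightarrow> d \<le> y \<Longrightarrow> d dvd N"
  shows "totient_density N * harm y \<le> 1"
proof -
  have "real (totient N) * inverse (real d) \<le> real (totient (N div d))" if "d \<in> {1..y}" for d
  proof -
    have d: "d dvd N" "d > 0" using that assms by auto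
    have "totient_density N \<le> totient_density (N div d)"
      using d assms by (intro totient_density_decrease) auto
    then show ?thesis
      using d assms by (auto simp: totient_density_def field_simps real_of_nat_div)
  qed
  then have "real (totient N) * harm y \<le> (\<Sum>d\<in>{1..y}. real (totient (N div d)))"
    by (auto simp: harm_def sum_distrib_left intro!: sum_mono)
  also have "\<dots> \<le> (\<Sum>d | d dvd N. real (totient (N div d)))"
    using assms by (intro sum_mono2) auto
  also have "\<dots> = real N"
    using assms(1) by (rule sum_totient_codivisors)
  finally show ?thesis using assms(1) by (simp add: totient_density_def field_simps)
qed

text \<open>The partial sums minus their linear trend \<open>N * m\<close> are again periodic, hence
  bounded, and vanish after division by \<open>N\<close>.\<close>

lemma periodic_mean_tendsto:
  fixes g :: "nat \<Rightarrow> real"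
  assumes P: "P > 0" and g: "\<And>n. g (n + P) = g n"
  shows "(\<lambda>N. (\<Sum>n\<in>{1..N}. g n) / real N) \<longlonglongrightarrow> (\<Sum>n\<in>{1..P}. g n) / real P"
proof -
  define m where "m = (\<Sum>n\<in>{1..P}. g n) / real P"
  define h where "h N = (\<Sum>n\<in>{1..N}. g n) - real N * m" for N
  have "(\<Sum>n\<in>{1..N + P}. g n) = (\<Sum>n\<in>{1..N}. g n) + (\<Sum>n\<in>{1..P}. g n)" for N
  proof (induction N)
    case (Suc N)
    then show ?case using g[of "Suc N"] by simp
  qed simp
  then have per: "h (N + P) = h N" for N
    using P by (simp add: h_def m_def field_simps)
  have "h (r + P * k) = h r" for r k
    by (induction k) (use per in \<open>auto simp: ac_simps\<close>, metis add.assoc add.commute per)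
  then have "h N = h (N mod P)" for N
    by (metis mod_mult_div_eq)
  then have b: "\<bar>h N\<bar> \<le> Max ((\<lambda>n. \<bar>h n\<bar>) ` {..<P})" for N
    using P by (metis Max_ge finite_imageI finite_lessThan image_eqI lessThan_iff mod_less_divisor)
  have "(\<lambda>N. h N / real N) \<longlonglongrightarrow> 0"
  proof (rule Lim_null_comparison)
    show "\<forall>\<^sub>F N in sequentially. norm (h N / real N) \<le> Max ((\<lambda>n. \<bar>h n\<bar>) ` {..<P}) / real N"
      using b by (intro always_eventually) (auto intro!: divide_right_mono)
    show "(\<lambda>N. Max ((\<lambda>n. \<bar>h n\<bar>) ` {..<P}) / real N) \<longlonglongrightarrow> 0"
      by (rule lim_const_over_n)
  qed
  then have "(\<lambda>N. m + h N / real N) \<longlonglongrightarrow> m"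
    using tendsto_add[OF tendsto_const[of m]] by fastforce
  moreover have "\<forall>\<^sub>F N in sequentially. m + h N / real N = (\<Sum>n\<in>{1..N}. g n) / real N"
    using eventually_gt_at_top[of 0] by eventually_elim (simp add: h_def field_simps)
  ultimately show ?thesis unfolding m_def[symmetric]
    by (rule Lim_transform_eventually)
qed

lemma two_power_card_prime_factors_le:
  assumes "(n::nat) > 0" "X \<subseteq> prime_factors n"
  shows "2 ^ card X \<le> n"
proof -
  have "card X \<le> card (prime_factors n)" using assms by (intro card_mono) auto
  then have "(2::nat) ^ card X \<le> 2 ^ card (prime_factors n)" by simp
  also have "\<dots> = (\<Prod>p\<in>prime_factors n. 2)" by simp
  also have "\<dots> \<le> (\<Prod>p\<in>prime_factors n. p ^ multiplicity p n)"
  proof (intro prod_mono conjI)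
    fix p assume p: "p \<in> prime_factors n"
    then have "prime p" "multiplicity p n > 0"
      by (auto simp: prime_factors_multiplicity)
    then have "p \<ge> 2" "p \<le> p ^ multiplicity p n"
      using prime_ge_2_nat[of p] self_le_power[of p] by simp_all
    then show "2 \<le> p ^ multiplicity p n" by simp
  qed simp
  also have "\<dots> = n" using assms by (simp add: prod_prime_factors)
  finally show ?thesis .
qed

lemma L_pos: "L t > 0"
  by (auto simp: L_def Lcm_0_iff intro!: Nat.gr0I)

lemma dvd_L: "1 \<le> d \<Longrightarrow> d \<le> t \<Longrightarrow> d dvd L t"
  by (simp add: L_def dvd_Lcm)

lemma le_L: "t \<le> L t"
  using dvd_L[of t t] L_pos[of t] by (cases t) (auto intro: dvd_imp_le)

section \<open>Primes modulo which \<open>q\<close> has a given multiplicative order\<close>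

definition primes_of_order :: "nat \<Rightarrow> nat \<Rightarrow> nat set" where
  "primes_of_order q k = {p. prime p \<and> ord p q = k}"

text \<open>For \<open>k = 0\<close> the sum runs over the primes dividing \<open>q\<close>, since
  \<open>ord\<close> is 0 without coprimality. Such primes never divide \<open>q ^ n - 1\<close> for
  \<open>n > 0\<close>, so order 0 is kept out below.\<close>

definition primes_of_order_sum :: "nat \<Rightarrow> nat \<Rightarrow> real" where
  "primes_of_order_sum q k = (\<Sum>p\<in>primes_of_order q k. 1 / real p)"

lemma primes_of_order_sum_nonneg: "0 \<le> primes_of_order_sum q k"
  by (auto simp: primes_of_order_sum_def intro: sum_nonneg)

context
  fixes q :: nat
  assumes q: "q \<ge> 2"
begin

lemma power_minus_1_pos: "n > 0 \<Longrightarrow> q ^ n - 1 > 0"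
  using q one_less_power[of q n] by simp

text \<open>All later statements about the primes in \<open>q ^ n - 1\<close> go through this
  translation into divisibility of orders.\<close>

lemma prime_factor_iff:
  assumes "n > 0"
  shows "p \<in> prime_factors (q ^ n - 1) \<longleftrightarrow> prime p \<and> ord p q dvd n"
proof -
  have "p dvd q ^ n - 1 \<longleftrightarrow> [q ^ n = 1] (mod p)"
    using q by (simp add: cong_altdef_nat)
  then show ?thesis
    using power_minus_1_pos[OF assms] ord_divides[of q n p] by (auto simp: prime_factors_dvd)
qed

lemma primes_of_order_subset:
  "k > 0 \<Longrightarrow> primes_of_order q k \<subseteq> prime_factors (q ^ k - 1)"
  using prime_factor_iff by (auto simp: primes_of_order_def)

lemma finite_primes_of_order: "k > 0 \<Longrightarrow> finite (primes_of_order q k)"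
  by (meson finite_set_mset finite_subset primes_of_order_subset)

text \<open>These primes all divide \<open>q ^ k - 1\<close>, and a positive number with
  \<open>c\<close> prime factors is at least \<open>2 ^ c\<close>. The crude
  \<open>q \<le> 2 ^ q\<close> turns this into a bound linear in \<open>k\<close>.\<close>

lemma card_primes_of_order:
  assumes "k > 0"
  shows "card (primes_of_order q k) \<le> q * k"
proof -
  have "2 ^ card (primes_of_order q k) \<le> q ^ k - 1"
    using assms primes_of_order_subset power_minus_1_pos
    by (intro two_power_card_prime_factors_le)
  also have "\<dots> \<le> q ^ k" by simp
  also have "\<dots> \<le> (2 ^ q) ^ k" by (intro power_mono) auto
  also have "\<dots> = 2 ^ (q * k)" by (simp add: power_mult)
  finally show ?thesis by simp
qed

text \<open>The primes of order \<open>k\<close> have the form \<open>1 + k j\<close>. There may be as many as \<open>q k\<close> of them, and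
  \<open>1 / j \<le> 1 / \<surd>k + \<surd>k / j\<^sup>2\<close> balances the small \<open>j\<close> against the large ones.\<close>

lemma primes_of_order_sum_le:
  assumes "k > 0"
  shows "primes_of_order_sum q k \<le> (real q + (\<Sum>j. 1 / real j ^ 2)) / sqrt (real k)"
proof -
  define T where "T = primes_of_order q k"
  define j where "j p = (p - 1) div k" for p
  define s where "s = sqrt (real k)"
  have s: "s > 0" "s * s = real k" using assms by (auto simp: s_def)
  have fin: "finite T" using assms by (simp add: T_def finite_primes_of_order)
  have pj: "p = 1 + k * j p" "j p > 0" if "p \<in> T" for p
  proof -
    have p: "prime p" "ord p q = k" using that by (auto simp: T_def primes_of_order_def)
    \<comment> \<open>The order \<open>k\<close> is positive, whereas \<open>ord\<close> would be 0
      if \<open>p\<close> divided \<open>q\<close>.\<close>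
    then have "coprime p q" using assms by (metis ord_def less_irrefl)
    then have "k dvd p - 1" using p order_divides_totient[of p q] totient_prime[of p] by simp
    then have "p - 1 = k * j p" by (simp add: j_def)
    then show "p = 1 + k * j p" using prime_gt_0_nat[OF p(1)] by simp
    then show "j p > 0" using prime_gt_1_nat[OF p(1)] by (cases "j p") auto
  qed
  have inj: "inj_on j T" by (intro inj_onI) (metis pj(1))
  have bound: "1 / real p \<le> (1 / k) * (1 / s + s * (1 / real (j p) ^ 2))" if "p \<in> T" for p
  proof -
    have p: "real p = 1 + real k * real (j p)"
      by (subst pj(1)[OF that]) simp
    have "0 < real k * real (j p)" using pj(2)[OF that] assms by simp
    then have "1 / real p \<le> 1 / (real k * real (j p))"
      unfolding p by (intro divide_left_mono) auto
    also have "\<dots> = (1 / k) * (1 / real (j p))" by simp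
    also have "\<dots> \<le> (1 / k) * (1 / s + s * (1 / real (j p) ^ 2))"
    proof (rule mult_left_mono)
      have x: "0 < real (j p)" using pj(2)[OF that] by simp
      \<comment> \<open>Expanded, this says that \<open>j s\<close> is at most the sum of the
        squares of \<open>j\<close> and \<open>s\<close>; dividing by \<open>s\<close> times the
        square of \<open>j\<close> gives the claim.\<close>
      have "0 \<le> (real (j p) - s)\<^sup>2 + real (j p) * s" using s by simp
      then have "real (j p) * s \<le> real (j p) ^ 2 + s * s"
        by (simp add: power2_eq_square algebra_simps)
      then have "real (j p) * s / (s * real (j p) ^ 2) \<le> (real (j p) ^ 2 + s * s) / (s * real (j p) ^ 2)"
        using s x by (intro divide_right_mono) auto
      then show "1 / real (j p) \<le> 1 / s + s * (1 / real (j p) ^ 2)"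
        using s(1) x by (simp add: add_divide_distrib power2_eq_square)
    qed simp
    finally show ?thesis .
  qed
  have "(\<Sum>p\<in>T. 1 / real (j p) ^ 2) = (\<Sum>i\<in>j ` T. 1 / real i ^ 2)"
    using inj by (simp add: sum.reindex)
  \<comment> \<open>The series starts at 0, where the term is 0 because division by zero gives
    0.\<close>
  also have "\<dots> \<le> (\<Sum>i. 1 / real i ^ 2)"
    using inverse_power_summable[of 2, where 'a=real] fin
    by (intro sum_le_suminf) (auto simp: inverse_eq_divide)
  finally have sq: "(\<Sum>p\<in>T. 1 / real (j p) ^ 2) \<le> (\<Sum>i. 1 / real i ^ 2)" .
  have "real (card T) \<le> real (q * k)"
    using card_primes_of_order[OF assms] unfolding T_def by (simp only: of_nat_le_iff)
  then have ca: "real (card T) \<le> real q * (s * s)" by (simp add: s)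
  have "primes_of_order_sum q k \<le> (\<Sum>p\<in>T. (1 / k) * (1 / s + s * (1 / real (j p) ^ 2)))"
    unfolding primes_of_order_sum_def T_def[symmetric] by (intro sum_mono bound)
  also have "\<dots> = (1 / k) * (real (card T) / s + s * (\<Sum>p\<in>T. 1 / real (j p) ^ 2))"
    unfolding sum_distrib_left[symmetric] sum.distrib by simp
  also have "\<dots> \<le> (1 / k) * (real q * (s * s) / s + s * (\<Sum>i. 1 / real i ^ 2))"
    using s sq ca by (intro mult_left_mono add_mono divide_right_mono) auto
  also have "\<dots> = (real q + (\<Sum>i. 1 / real i ^ 2)) / s"
    using s by (simp add: field_simps flip: s(2))
  finally show ?thesis by (simp add: s_def)
qed

lemma summable_primes_of_order_sum: "summable (\<lambda>k. primes_of_order_sum q k / real k)"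
proof (rule summable_comparison_test')
  let ?C = "real q + (\<Sum>j. 1 / real j ^ 2)"
  show "summable (\<lambda>k. ?C * real k powr (-3/2))"
    by (intro summable_mult) (simp add: summable_real_powr_iff)
  fix k :: nat assume "k \<ge> 1"
  then have k: "real k > 0" by simp
  have "primes_of_order_sum q k / real k \<le> ?C / sqrt (real k) / real k"
    using primes_of_order_sum_le k by (intro divide_right_mono) auto
  also have "\<dots> = ?C * (real k powr (-1/2) * real k powr (-1))"
    using k by (simp add: powr_minus powr_half_sqrt field_simps)
  also have "\<dots> = ?C * real k powr (-3/2)"
    by (subst powr_add[symmetric]) simp
  finally show "norm (primes_of_order_sum q k / real k) \<le> ?C * real k powr (-3/2)"
    using primes_of_order_sum_nonneg by simp
qed

lemma sum_primes_of_order_sum: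
  assumes "finite K" "0 \<notin> K"
  shows "(\<Sum>k\<in>K. primes_of_order_sum q k) = (\<Sum>p\<in>(\<Union>k\<in>K. primes_of_order q k). 1 / real p)"
  unfolding primes_of_order_sum_def using assms
  by (subst sum.UNION_disjoint)
     (auto simp: primes_of_order_def intro!: finite_primes_of_order[unfolded primes_of_order_def] Nat.gr0I)

text \<open>After exchanging the sums, each \<open>k\<close> occurs at most \<open>N / k\<close>
  times. A large \<open>t\<close> gives the truncation error, and \<open>t = 0\<close> the estimate
  behind positivity.\<close>

lemma sum_divisors_primes_of_order_sum_le:
  "(\<Sum>n\<in>{1..N}. \<Sum>k | k dvd n \<and> t < k. primes_of_order_sum q k)
     \<le> real N * (\<Sum>k\<in>{t<..N}. primes_of_order_sum q k / real k)"
proof -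
  have "(\<Sum>n\<in>{1..N}. \<Sum>k | k dvd n \<and> t < k. primes_of_order_sum q k)
      = (\<Sum>n\<in>{1..N}. \<Sum>k\<in>{t<..N}. if k dvd n then primes_of_order_sum q k else 0)"
  proof (rule sum.cong[OF refl])
    fix n assume n: "n \<in> {1..N}"
    then have "{k. k dvd n \<and> t < k} = {k\<in>{t<..N}. k dvd n}"
      by (auto dest: dvd_imp_le)
    then show "(\<Sum>k | k dvd n \<and> t < k. primes_of_order_sum q k)
      = (\<Sum>k\<in>{t<..N}. if k dvd n then primes_of_order_sum q k else 0)"
      by (simp only: sum.inter_filter finite_greaterThanAtMost)
  qed
  also have "\<dots> = (\<Sum>k\<in>{t<..N}. \<Sum>n\<in>{1..N}. if k dvd n then primes_of_order_sum q k else 0)"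
    by (rule sum.swap)
  also have "\<dots> \<le> (\<Sum>k\<in>{t<..N}. real N * (primes_of_order_sum q k / real k))"
  proof (intro sum_mono)
    fix k assume "k \<in> {t<..N}"
    then have "{n\<in>{1..N}. k dvd n} \<subseteq> (*) k ` {1..N div k}"
      by (auto simp: less_eq_div_iff_mult_less_eq mult.commute elim!: dvdE)
    then have "card {n\<in>{1..N}. k dvd n} \<le> card ((*) k ` {1..N div k})"
      by (intro card_mono) auto
    also have "\<dots> \<le> N div k" by (metis card_image_le card_atLeastAtMost diff_Suc_1 finite_atLeastAtMost)
    finally have "real (card {n\<in>{1..N}. k dvd n}) \<le> real N / real k"
      by (meson of_nat_div_le_of_nat of_nat_le_iff order_trans)
    then have "real (card {n\<in>{1..N}. k dvd n}) * primes_of_order_sum q k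
        \<le> real N / real k * primes_of_order_sum q k"
      by (intro mult_right_mono primes_of_order_sum_nonneg)
    then show "(\<Sum>n\<in>{1..N}. if k dvd n then primes_of_order_sum q k else 0)
        \<le> real N * (primes_of_order_sum q k / real k)"
      by (simp flip: sum.inter_filter)
  qed
  finally show ?thesis by (simp add: sum_distrib_left)
qed

end

text \<open>The proportion of generators within the multiplicative group. Unlike \<open>rho\<close>,
  which divides by \<open>q ^ n\<close>, it is an exact totient density and so a product over
  primes.\<close>

definition primitive_density :: "nat \<Rightarrow> nat \<Rightarrow> real" where
  "primitive_density q n = totient_density (q ^ n - 1)"

lemma primitive_density_bounds: "0 \<le> primitive_density q n" "primitive_density q n \<le> 1"
  by (simp_all add: primitive_density_def totient_density_nonneg totient_density_le_1)

section \<open>Truncation at \<open>L t\<close> and the mean of the primitive density\<close>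

context
  fixes q :: nat
  assumes q: "q \<ge> 2"
begin

lemma power_minus_1_dvd:
  assumes "m dvd n"
  shows "q ^ m - 1 dvd q ^ n - 1"
proof -
  have "[q ^ m = 1] (mod (q ^ m - 1))"
    using q by (simp add: cong_altdef_nat)
  then have "[q ^ n = 1] (mod (q ^ m - 1))"
    using assms unfolding ord_divides by (rule dvd_trans)
  then show ?thesis using q by (simp add: cong_altdef_nat)
qed

lemma primitive_density_gcd_ge:
  "n > 0 \<Longrightarrow> primitive_density q n \<le> primitive_density q (gcd n m)"
  unfolding primitive_density_def
  by (intro totient_density_decrease power_minus_1_dvd power_minus_1_pos q) auto

text \<open>A prime dividing \<open>q\<^sup>n - 1\<close> but not \<open>q\<^sup>g - 1\<close>, where \<open>g = gcd n (L t)\<close>, has order dividing \<open>n\<close>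
  and exceeding \<open>t\<close>, because every order up to \<open>t\<close> divides \<open>L t\<close>.\<close>

lemma primitive_density_gcd_L_diff_le:
  assumes "n > 0"
  shows "primitive_density q (gcd n (L t)) - primitive_density q n
           \<le> (\<Sum>k | k dvd n \<and> t < k. primes_of_order_sum q k)"
proof -
  let ?g = "gcd n (L t)"
  let ?K = "{k. k dvd n \<and> t < k}"
  have K: "finite ?K" "0 \<notin> ?K" using assms by auto
  have "prime_factors (q ^ n - 1) - prime_factors (q ^ ?g - 1) \<subseteq> (\<Union>k\<in>?K. primes_of_order q k)"
  proof
    fix p assume p: "p \<in> prime_factors (q ^ n - 1) - prime_factors (q ^ ?g - 1)"
    then have "prime p" "ord p q dvd n" "\<not> ord p q dvd L t"
      using prime_factor_iff[OF q assms, of p] prime_factor_iff[OF q, of ?g p] assms by auto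
    moreover from this have "ord p q \<ge> 1" using assms by (cases "ord p q") auto
    then have "t < ord p q"
      using dvd_L[of "ord p q" t] \<open>\<not> ord p q dvd L t\<close> by linarith
    ultimately show "p \<in> (\<Union>k\<in>?K. primes_of_order q k)"
      by (auto simp: primes_of_order_def)
  qed
  moreover have "finite (\<Union>k\<in>?K. primes_of_order q k)"
    using K by (auto intro!: finite_primes_of_order[OF q] Nat.gr0I)
  ultimately have "(\<Sum>p\<in>prime_factors (q ^ n - 1) - prime_factors (q ^ ?g - 1). 1 / real p)
      \<le> (\<Sum>k | k dvd n \<and> t < k. primes_of_order_sum q k)"
    unfolding sum_primes_of_order_sum[OF q K] by (intro sum_mono2) auto
  moreover have "primitive_density q ?g - primitive_density q n
      \<le> (\<Sum>p\<in>prime_factors (q ^ n - 1) - prime_factors (q ^ ?g - 1). 1 / real p)"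
    unfolding primitive_density_def
    by (intro totient_density_decrease power_minus_1_dvd power_minus_1_pos q) (use assms in auto)
  ultimately show ?thesis by linarith
qed

text \<open>The primes dividing \<open>q ^ n - 1\<close> are sorted by their order, and
  \<open>1 - x \<ge> exp (- 2 * x)\<close> on \<open>[0, 1/2]\<close> is applied to each
  \<open>x = 1 / p\<close>.\<close>

lemma primitive_density_ge_exp:
  assumes "n > 0"
  shows "exp (- 2 * (\<Sum>k | k dvd n \<and> 0 < k. primes_of_order_sum q k)) \<le> primitive_density q n"
proof -
  let ?K = "{k. k dvd n \<and> 0 < k}"
  have K: "finite ?K" "0 \<notin> ?K" using assms by auto
  have "prime_factors (q ^ n - 1) = (\<Union>k\<in>?K. primes_of_order q k)"
    using assms prime_factor_iff[OF q assms] by (auto simp: primes_of_order_def intro!: Nat.gr0I)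
  then have "(\<Sum>k\<in>?K. primes_of_order_sum q k) = (\<Sum>p\<in>prime_factors (q ^ n - 1). 1 / real p)"
    by (simp only: sum_primes_of_order_sum[OF q K])
  then have "exp (- 2 * (\<Sum>k\<in>?K. primes_of_order_sum q k))
      = (\<Prod>p\<in>prime_factors (q ^ n - 1). exp (- 2 * (1 / real p)))"
    by (simp only: sum_distrib_left exp_sum finite_set_mset)
  also have "\<dots> \<le> (\<Prod>p\<in>prime_factors (q ^ n - 1). 1 - 1 / real p)"
  proof (intro prod_mono conjI)
    fix p assume "p \<in> prime_factors (q ^ n - 1)"
    then have "p \<ge> 2" by (auto intro: prime_ge_2_nat)
    define x where "x = 1 / real p"
    have x: "0 \<le> x" "x \<le> 1 / 2" using \<open>p \<ge> 2\<close> by (auto simp: x_def field_simps)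
    have "x * x \<le> x * (1 / 2)" using x by (intro mult_left_mono)
    \<comment> \<open>Here \<open>x \<le> 1 / 2\<close> absorbs the quadratic term of the lower
      bound for \<open>ln (1 - x)\<close>.\<close>
    then have "- 2 * x \<le> - x - 2 * x\<^sup>2" by (simp add: power2_eq_square)
    also have "\<dots> \<le> ln (1 - x)" using x by (rule ln_one_minus_pos_lower_bound)
    finally show "exp (- 2 * (1 / real p)) \<le> 1 - 1 / real p"
      using x by (simp add: ln_ge_iff x_def[symmetric])
  qed simp
  also have "\<dots> = primitive_density q n"
    unfolding primitive_density_def using power_minus_1_pos[OF q assms]
    by (rule totient_density_eq_prod[symmetric])
  finally show ?thesis .
qed

text \<open>The error is a segment beyond \<open>t\<close> of a convergent series, so a single
  \<open>t\<close> serves all \<open>N\<close> at once.\<close>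

lemma mean_gcd_L_bounds:
  defines "M \<equiv> \<lambda>N. (\<Sum>n\<in>{1..N}. primitive_density q n) / real N"
  assumes N: "N > 0"
  shows "M N \<le> (\<Sum>n\<in>{1..N}. primitive_density q (gcd n (L t))) / real N"
    and "(\<Sum>n\<in>{1..N}. primitive_density q (gcd n (L t))) / real N
          \<le> M N + (\<Sum>k\<in>{t<..N}. primes_of_order_sum q k / real k)"
proof -
  show "M N \<le> (\<Sum>n\<in>{1..N}. primitive_density q (gcd n (L t))) / real N"
    unfolding M_def by (intro divide_right_mono sum_mono primitive_density_gcd_ge) auto
  have "(\<Sum>n\<in>{1..N}. primitive_density q (gcd n (L t)))
      \<le> (\<Sum>n\<in>{1..N}. primitive_density q n + (\<Sum>k | k dvd n \<and> t < k. primes_of_order_sum q k))"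
    using primitive_density_gcd_L_diff_le[of _ t] by (intro sum_mono) (auto simp: diff_le_eq add.commute)
  also have "\<dots> \<le> (\<Sum>n\<in>{1..N}. primitive_density q n)
      + real N * (\<Sum>k\<in>{t<..N}. primes_of_order_sum q k / real k)"
    unfolding sum.distrib using sum_divisors_primes_of_order_sum_le[OF q] by (intro add_left_mono)
  finally show "(\<Sum>n\<in>{1..N}. primitive_density q (gcd n (L t))) / real N
      \<le> M N + (\<Sum>k\<in>{t<..N}. primes_of_order_sum q k / real k)"
    using N by (simp add: M_def field_simps)
qed

text \<open>The truncated means converge by periodicity and approximate \<open>M\<close> uniformly
  in \<open>N\<close>, so \<open>M\<close> is Cauchy. Evaluating at \<open>N = L t\<close>
  identifies the two limits.\<close>

lemma primitive_density_mean_converges: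
  obtains l where "l > 0"
    "(\<lambda>N. (\<Sum>n\<in>{1..N}. primitive_density q n) / real N) \<longlonglongrightarrow> l"
    "(\<lambda>t. (\<Sum>n\<in>{1..L t}. primitive_density q (gcd n (L t))) / real (L t)) \<longlonglongrightarrow> l"
proof -
  define M where "M N = (\<Sum>n\<in>{1..N}. primitive_density q n) / real N" for N
  define MG where "MG t N = (\<Sum>n\<in>{1..N}. primitive_density q (gcd n (L t))) / real N" for t N
  have approx: "\<exists>t0. \<forall>t\<ge>t0. \<forall>N>0. \<bar>MG t N - M N\<bar> < e" if e: "e > 0" for e
  proof -
    obtain t0 where t0: "norm (sum (\<lambda>k. primes_of_order_sum q k / real k) {m..<n}) < e"
      if "m \<ge> t0" for m n
      using summable_primes_of_order_sum[OF q] e unfolding summable_Cauchy by meson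
    have "\<bar>MG t N - M N\<bar> < e" if "t \<ge> t0" "N > 0" for t N
    proof -
      have "{t<..N} = {Suc t..<Suc N}" by auto
      then have "(\<Sum>k\<in>{t<..N}. primes_of_order_sum q k / real k) < e"
        using t0[of "Suc t" "Suc N"] that by simp
      then show ?thesis
        using mean_gcd_L_bounds[OF that(2), of t] by (simp add: M_def MG_def)
    qed
    then show ?thesis by blast
  qed
  have "Cauchy M"
  proof (rule metric_CauchyI)
    fix e :: real assume "e > 0"
    \<comment> \<open>Four errors of \<open>e / 4\<close> occur: for each of the two indices, from
      \<open>M\<close> to \<open>MG t\<close> and from there to the limit.\<close>
    then obtain t where t: "\<bar>MG t N - M N\<bar> < e / 4" if "N > 0" for N
      using approx[of "e / 4"] by auto
    have "MG t \<longlonglongrightarrow> (\<Sum>n\<in>{1..L t}. primitive_density q (gcd n (L t))) / real (L t)"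
      unfolding MG_def by (rule periodic_mean_tendsto) (auto simp: L_pos)
    from LIMSEQ_D[OF this, of "e / 4"] obtain N0 where N0:
      "\<bar>MG t N - (\<Sum>n\<in>{1..L t}. primitive_density q (gcd n (L t))) / real (L t)\<bar> < e / 4"
      if "N \<ge> N0" for N using \<open>e > 0\<close> by auto
    have "dist (M m) (M n) < e" if "m \<ge> Suc N0" "n \<ge> Suc N0" for m n
      using N0[of m] N0[of n] t[of m] t[of n] that unfolding dist_real_def by linarith
    then show "\<exists>N0. \<forall>m\<ge>N0. \<forall>n\<ge>N0. dist (M m) (M n) < e" by blast
  qed
  then obtain l where l: "M \<longlonglongrightarrow> l"
    using Cauchy_convergent convergent_def by blast

  \<comment> \<open>Uniformity in \<open>N\<close> is what permits \<open>N\<close> to depend on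
    \<open>t\<close>.\<close>
  have "(\<lambda>t. MG t (L t) - M (L t)) \<longlonglongrightarrow> 0"
    using approx by (intro LIMSEQ_I) (simp add: L_pos, meson L_pos)
  moreover have "filterlim L at_top sequentially"
    using le_L by (intro filterlim_at_top_mono[OF filterlim_ident]) auto
  with l have "(\<lambda>t. M (L t)) \<longlonglongrightarrow> l"
    by (rule filterlim_compose)
  ultimately have MG: "(\<lambda>t. MG t (L t)) \<longlonglongrightarrow> l"
    using tendsto_add by fastforce

  define G where "G = (\<Sum>k. primes_of_order_sum q k / real k)"
  have "exp (- 2 * G) \<le> M N" if N: "N > 0" for N
  proof -
    define D where "D n = (\<Sum>k | k dvd n \<and> 0 < k. primes_of_order_sum q k)" for n
    have "(\<Sum>n\<in>{1..N}. D n) \<le> real N * (\<Sum>k\<in>{0<..N}. primes_of_order_sum q k / real k)"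
      unfolding D_def by (rule sum_divisors_primes_of_order_sum_le[OF q])
    also have "\<dots> \<le> real N * G"
      unfolding G_def using summable_primes_of_order_sum[OF q] primes_of_order_sum_nonneg
      by (intro mult_left_mono sum_le_suminf) auto
    finally have D: "(\<Sum>n\<in>{1..N}. D n) \<le> real N * G" .
    \<comment> \<open>Jensen's inequality, by means of the tangent of \<open>exp\<close> at \<open>- 2 * G\<close>\<close>
    have "real N * exp (- 2 * G)
        \<le> exp (- 2 * G) * (real N + 2 * (real N * G - (\<Sum>n\<in>{1..N}. D n)))"
      using D by (simp add: algebra_simps)
    also have "\<dots> = (\<Sum>n\<in>{1..N}. exp (- 2 * G) * (1 + 2 * (G - D n)))"
      unfolding sum_distrib_left[symmetric] sum.distrib sum_subtractf by simp
    also have "\<dots> \<le> (\<Sum>n\<in>{1..N}. primitive_density q n)"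
    proof (rule sum_mono)
      fix n assume "n \<in> {1..N}"
      then have "exp (- 2 * D n) \<le> primitive_density q n"
        using primitive_density_ge_exp[of n] by (simp add: D_def)
      moreover have "exp (- 2 * G) * (1 + 2 * (G - D n)) \<le> exp (- 2 * G) * exp (2 * (G - D n))"
        by (intro mult_left_mono exp_ge_add_one_self) auto
      moreover have "\<dots> = exp (- 2 * D n)" by (simp flip: exp_add add: algebra_simps)
      ultimately show "exp (- 2 * G) * (1 + 2 * (G - D n)) \<le> primitive_density q n" by linarith
    qed
    finally show ?thesis using N by (simp add: M_def field_simps)
  qed
  \<comment> \<open>The bound starts at index 1, as \<open>M 0\<close> is 0.\<close>
  then have "exp (- 2 * G) \<le> l"
    using l by (intro LIMSEQ_le_const[of M l]) (auto intro!: exI[of _ 1])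
  then have "l > 0" by (rule less_le_trans[OF exp_gt_zero])
  then show thesis using that l MG unfolding M_def[abs_def] MG_def by blast
qed

section \<open>From the primitive density back to \<open>rho\<close> and \<open>A\<close>\<close>

lemma rho_eq: "n > 0 \<Longrightarrow> rho q n = primitive_density q n - primitive_density q n / real q ^ n"
proof -
  assume "n > 0"
  then have pos: "real (q ^ n - 1) > 0" by (simp only: of_nat_0_less_iff power_minus_1_pos[OF q])
  have eq: "real q ^ n = real (q ^ n - 1) + 1" using q by (simp add: of_nat_diff)
  have "y / (x + 1) = y / x - y / x / (x + 1)" if "x > 0" for x y :: real
    using that by (simp add: divide_simps) (simp add: algebra_simps)
  from this[OF pos] show ?thesis
    unfolding rho_def primitive_density_def totient_density_def of_nat_power eq .
qed

text \<open>The two normalisations differ by the factor \<open>1 - 1 / q ^ n\<close>, and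
  \<open>q \<ge> 2\<close>. The error is thus summable over \<open>n\<close>.\<close>

lemma abs_rho_diff_le:
  assumes "n > 0"
  shows "\<bar>rho q n - primitive_density q n\<bar> \<le> (1 / 2) ^ n"
proof -
  have "primitive_density q n / real q ^ n \<le> 1 / 2 ^ n"
    using q primitive_density_bounds by (intro frac_le power_mono) auto
  then show ?thesis
    using assms primitive_density_bounds by (simp add: rho_eq power_one_over)
qed

end

text \<open>This is the weight of a fixed \<open>r\<close> in \<open>A q t\<close>. With
  \<open>L t = r * N\<close>, every \<open>d \<le> t div r\<close> divides \<open>N\<close>, because
  \<open>r * d \<le> t\<close> divides \<open>L t\<close>; the harmonic bound then applies to
  \<open>N\<close>.\<close>

lemma totient_codivisor_L_tendsto_0:
  assumes "r > 0"
  shows "(\<lambda>t. if r dvd L t then real (totient (L t div r)) / real (L t) else 0) \<longlonglongrightarrow> 0"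
proof (rule Lim_null_comparison)
  have "filterlim (\<lambda>t. t div r) at_top sequentially"
    using assms by (intro filterlim_at_top_div_const_nat)
  then show "(\<lambda>t. inverse (harm (t div r) :: real)) \<longlonglongrightarrow> 0"
    by (intro tendsto_inverse_0_at_top filterlim_compose[OF harm_at_top])
  show "\<forall>\<^sub>F t in sequentially.
      norm (if r dvd L t then real (totient (L t div r)) / real (L t) else 0) \<le> inverse (harm (t div r))"
    using eventually_ge_at_top[of r]
  proof eventually_elim
    fix t assume "t \<ge> r"
    have "real (totient (L t div r)) / real (L t) \<le> inverse (harm (t div r))" if r: "r dvd L t"
    proof -
      obtain N where N: "L t = r * N" using r by blast
      then have "N > 0" using L_pos[of t] by (cases N) auto
      have "d dvd N" if "1 \<le> d" "d \<le> t div r" for d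
      proof -
        have "r * d dvd L t"
          using that assms by (intro dvd_L) (auto simp: less_eq_div_iff_mult_less_eq mult.commute)
        then show ?thesis using assms by (simp add: N)
      qed
      then have "totient_density N * harm (t div r) \<le> 1"
        using \<open>N > 0\<close> by (intro totient_density_le_inverse_harm)
      moreover have "harm (t div r) > (0::real)"
        using \<open>t \<ge> r\<close> assms by (simp add: div_greater_zero_iff)
      ultimately have "totient_density N \<le> inverse (harm (t div r))"
        by (simp add: field_simps)
      moreover have "real (totient N) / real (r * N) \<le> real (totient N) / real N"
        using assms \<open>N > 0\<close> by (intro divide_left_mono) auto
      ultimately show ?thesis using assms by (simp add: N totient_density_def)
    qed
    then show "norm (if r dvd L t then real (totient (L t div r)) / real (L t) else 0)
        \<le> inverse (harm (t div r))"
      by (simp add: harm_nonneg)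
  qed
qed

text \<open>The weights \<open>w t r\<close> over the divisors \<open>r\<close> of
  \<open>L t\<close> add up to 1. Those with \<open>r \<le> R\<close> are finitely many null
  sequences, and the rest contribute at most \<open>(1 / 2) ^ R\<close>.\<close>

lemma geometric_gcd_L_mean_tendsto_0:
  "(\<lambda>t. (\<Sum>r | r dvd L t. (1 / 2) ^ r * real (totient (L t div r))) / real (L t)) \<longlonglongrightarrow> 0"
proof -
  define w where "w t r = (if r dvd L t then real (totient (L t div r)) / real (L t) else 0)" for t r
  have w0: "0 \<le> w t r" for t r by (simp add: w_def)
  define S where "S t = (\<Sum>r | r dvd L t. (1 / 2) ^ r * real (totient (L t div r))) / real (L t)" for t
  have S_le: "S t \<le> (\<Sum>r\<in>{1..R}. w t r) + (1 / 2) ^ R" for t R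
  proof -
    let ?V = "{r. r dvd L t}"
    have fin: "finite ?V" using L_pos[of t] by simp
    have pos: "r > 0" if "r dvd L t" for r using that L_pos[of t] by (cases r) auto
    have "S t = (\<Sum>r\<in>?V. (1 / 2) ^ r * w t r)"
      by (simp add: S_def w_def sum_divide_distrib)
    also have "\<dots> \<le> (\<Sum>r\<in>?V. (if r \<in> {1..R} then w t r else 0) + (1 / 2) ^ R * w t r)"
    proof (rule sum_mono)
      fix r assume r: "r \<in> ?V"
      show "(1 / 2) ^ r * w t r \<le> (if r \<in> {1..R} then w t r else 0) + (1 / 2) ^ R * w t r"
      proof (cases "r \<le> R")
        case True
        have "(1 / 2) ^ r * w t r \<le> w t r"
          using w0 by (intro mult_left_le_one_le) (auto intro: power_le_one)
        moreover have "0 \<le> (1 / 2) ^ R * w t r" using w0 by simp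
        ultimately show ?thesis using True pos[of r] r by simp
      next
        case False
        then show ?thesis
          using w0 by (auto intro!: mult_right_mono power_decreasing)
      qed
    qed
    also have "\<dots> = (\<Sum>r\<in>?V. if r \<in> {1..R} then w t r else 0) + (1 / 2) ^ R * (\<Sum>r\<in>?V. w t r)"
      by (simp only: sum.distrib sum_distrib_left)
    also have "(\<Sum>r\<in>?V. w t r) = 1"
      using sum_totient_codivisors[OF L_pos[of t]] L_pos[of t]
      by (simp add: w_def flip: sum_divide_distrib)
    also have "(\<Sum>r\<in>?V. if r \<in> {1..R} then w t r else 0) \<le> (\<Sum>r\<in>{1..R}. w t r)"
      unfolding sum.inter_restrict[OF fin, symmetric] using w0 by (intro sum_mono2) auto
    finally show ?thesis by simp
  qed
  have "S \<longlonglongrightarrow> 0"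
  proof (rule order_tendstoI)
    fix a :: real assume "a < 0"
    moreover have "0 \<le> S t" for t by (auto simp: S_def intro!: divide_nonneg_nonneg sum_nonneg)
    ultimately show "\<forall>\<^sub>F t in sequentially. a < S t" by (intro always_eventually allI) (rule less_le_trans)
  next
    fix a :: real assume a: "0 < a"
    then obtain R where R: "(1 / 2) ^ R < a"
      using real_arch_pow_inv[of a "1 / 2"] by auto
    have "(\<lambda>t. (\<Sum>r\<in>{1..R}. w t r) + (1 / 2) ^ R) \<longlonglongrightarrow> (\<Sum>r\<in>{1..R}. 0) + (1 / 2) ^ R"
      unfolding w_def by (intro tendsto_add tendsto_sum tendsto_const totient_codivisor_L_tendsto_0) auto
    then have "\<forall>\<^sub>F t in sequentially. (\<Sum>r\<in>{1..R}. w t r) + (1 / 2) ^ R < a"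
      using R by (intro order_tendstoD) auto
    then show "\<forall>\<^sub>F t in sequentially. S t < a"
      by eventually_elim (use S_le in \<open>rule le_less_trans\<close>)
  qed
  then show ?thesis unfolding S_def[abs_def] .
qed

text \<open>The mean up to real \<open>x\<close> is the mean up to its floor times
  \<open>floor x / x\<close>, a factor tending to 1.\<close>

lemma sum_upto_real_mean_tendsto:
  fixes g :: "nat \<Rightarrow> real"
  assumes "(\<lambda>N. (\<Sum>n\<in>{1..N}. g n) / real N) \<longlonglongrightarrow> l"
  shows "((\<lambda>x::real. (1 / x) * (\<Sum>n | n \<ge> 1 \<and> real n \<le> x. g n)) \<longlongrightarrow> l) at_top"
proof -
  define N where "N x = nat \<lfloor>x\<rfloor>" for x :: real
  have "filterlim N at_top at_top"
    unfolding N_def by (intro filterlim_compose[OF filterlim_nat_sequentially] filterlim_floor_sequentially)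
  from filterlim_compose[OF assms this]
  have 1: "((\<lambda>x. (\<Sum>n\<in>{1..N x}. g n) / real (N x)) \<longlongrightarrow> l) at_top" .
  have "((\<lambda>x::real. of_int \<lfloor>x\<rfloor> / x) \<longlongrightarrow> 1) at_top"
  proof (rule tendsto_sandwich)
    have "((\<lambda>x::real. 1 - inverse x) \<longlongrightarrow> 1 - 0) at_top"
      by (intro tendsto_diff tendsto_const tendsto_inverse_0_at_top filterlim_ident)
    then show "((\<lambda>x::real. 1 - inverse x) \<longlongrightarrow> 1) at_top" by simp
    show "\<forall>\<^sub>F x::real in at_top. 1 - inverse x \<le> of_int \<lfloor>x\<rfloor> / x"
      using eventually_gt_at_top[of 0]
    proof eventually_elim
      fix x :: real assume "x > 0"
      moreover have "x - 1 \<le> of_int \<lfloor>x\<rfloor>" by linarith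
      ultimately have "(x - 1) / x \<le> of_int \<lfloor>x\<rfloor> / x" by (intro divide_right_mono) auto
      then show "1 - inverse x \<le> of_int \<lfloor>x\<rfloor> / x"
        using \<open>x > 0\<close> by (simp add: diff_divide_distrib inverse_eq_divide)
    qed
    show "\<forall>\<^sub>F x::real in at_top. of_int \<lfloor>x\<rfloor> / x \<le> 1"
      using eventually_gt_at_top[of 0] by eventually_elim simp
  qed simp
  then have 2: "((\<lambda>x. (\<Sum>n\<in>{1..N x}. g n) / real (N x) * (of_int \<lfloor>x\<rfloor> / x)) \<longlongrightarrow> l * 1) at_top"
    using 1 by (intro tendsto_mult)
  have "\<forall>\<^sub>F x in at_top. (\<Sum>n\<in>{1..N x}. g n) / real (N x) * (of_int \<lfloor>x\<rfloor> / x)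
      = (1 / x) * (\<Sum>n | n \<ge> 1 \<and> real n \<le> x. g n)"
    using eventually_ge_at_top[of 1]
  proof eventually_elim
    fix x :: real assume x: "x \<ge> 1"
    then have "real (N x) = of_int \<lfloor>x\<rfloor>" "real (N x) > 0" by (auto simp: N_def)
    moreover have "{n. n \<ge> 1 \<and> real n \<le> x} = {1..N x}"
      using x by (auto simp: N_def le_nat_iff le_floor_iff)
    ultimately show "(\<Sum>n\<in>{1..N x}. g n) / real (N x) * (of_int \<lfloor>x\<rfloor> / x)
      = (1 / x) * (\<Sum>n | n \<ge> 1 \<and> real n \<le> x. g n)" by simp
  qed
  from Lim_transform_eventually[OF 2 this] show ?thesis by simp
qed

text \<open>Both \<open>A\<close> and the mean of \<open>rho\<close> differ from means of
  \<open>primitive_density\<close> by null sequences. The last limit is kept because bounds on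
  \<open>primitive_density\<close> pass to \<open>l\<close> directly.\<close>

lemma mean_limits:
  assumes q: "q \<ge> 2"
  obtains l where "l > 0" "A q \<longlonglongrightarrow> l" "(\<lambda>N. (\<Sum>n\<in>{1..N}. rho q n) / real N) \<longlonglongrightarrow> l"
    "(\<lambda>N. (\<Sum>n\<in>{1..N}. primitive_density q n) / real N) \<longlonglongrightarrow> l"
proof -
  obtain l where l: "l > 0"
    and M: "(\<lambda>N. (\<Sum>n\<in>{1..N}. primitive_density q n) / real N) \<longlonglongrightarrow> l"
    and B: "(\<lambda>t. (\<Sum>n\<in>{1..L t}. primitive_density q (gcd n (L t))) / real (L t)) \<longlonglongrightarrow> l"
    using primitive_density_mean_converges[OF q] by blast
  have "(\<lambda>t. A q t - (\<Sum>n\<in>{1..L t}. primitive_density q (gcd n (L t))) / real (L t)) \<longlonglongrightarrow> 0"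
  proof (rule Lim_null_comparison[OF always_eventually geometric_gcd_L_mean_tendsto_0], rule allI)
    fix t
    have pos: "r > 0" if "r dvd L t" for r using that L_pos[of t] by (cases r) auto
    have "A q t - (\<Sum>n\<in>{1..L t}. primitive_density q (gcd n (L t))) / real (L t)
      = (\<Sum>r | r dvd L t. (rho q r - primitive_density q r) * real (totient (L t div r))) / real (L t)"
      unfolding A_def sum_gcd_eq[OF L_pos, of "primitive_density q"]
      by (simp add: left_diff_distrib sum_subtractf diff_divide_distrib)
    also have "norm \<dots> \<le> (\<Sum>r | r dvd L t. (1 / 2) ^ r * real (totient (L t div r))) / real (L t)"
      unfolding real_norm_def abs_divide abs_of_nat
      using abs_rho_diff_le[OF q] pos
      by (intro divide_right_mono order_trans[OF sum_abs] sum_mono) (auto simp: abs_mult intro!: mult_right_mono)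
    finally show "norm (A q t - (\<Sum>n\<in>{1..L t}. primitive_density q (gcd n (L t))) / real (L t))
        \<le> (\<Sum>r | r dvd L t. (1 / 2) ^ r * real (totient (L t div r))) / real (L t)" .
  qed
  from tendsto_add[OF this B] have a: "A q \<longlonglongrightarrow> l" by simp
  have "(\<lambda>N. (\<Sum>n\<in>{1..N}. rho q n) / real N - (\<Sum>n\<in>{1..N}. primitive_density q n) / real N) \<longlonglongrightarrow> 0"
  proof (rule Lim_null_comparison[OF always_eventually lim_const_over_n[of 2]], rule allI)
    fix N
    have "\<bar>\<Sum>n\<in>{1..N}. rho q n - primitive_density q n\<bar> \<le> (\<Sum>n\<in>{1..N}. (1 / 2) ^ n)"
      using abs_rho_diff_le[OF q] by (intro order_trans[OF sum_abs] sum_mono) auto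
    also have "\<dots> \<le> (\<Sum>n. (1 / 2) ^ n)"
      by (intro sum_le_suminf summable_geometric) auto
    also have "\<dots> = (2::real)" by (subst suminf_geometric) auto
    finally show "norm ((\<Sum>n\<in>{1..N}. rho q n) / real N - (\<Sum>n\<in>{1..N}. primitive_density q n) / real N)
        \<le> 2 / real N"
      by (simp add: sum_subtractf divide_right_mono flip: diff_divide_distrib)
  qed
  from tendsto_add[OF this M] have "(\<lambda>N. (\<Sum>n\<in>{1..N}. rho q n) / real N) \<longlonglongrightarrow> l" by simp
  with that l a M show thesis by blast
qed

section \<open>Prime powers with small mean density\<close>

text \<open>If \<open>P\<close> is odd, powers \<open>q\<close> of two with exponent divisible by \<open>totient P\<close> are \<open>1\<close> modulo \<open>P\<close>, so \<open>P\<close>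
  divides every \<open>q\<^sup>n - 1\<close>. The odd part of \<open>L t\<close> is used for \<open>P\<close>; discarding the powers of two costs
  a factor two in the totient density.\<close>

lemma exists_odd_small_totient_density:
  assumes "e > 0"
  obtains P where "odd P" "totient_density P < e"
proof -
  \<comment> \<open>The 2 in the threshold pays for the factor lost with the powers of two.\<close>
  have "\<forall>\<^sub>F t in sequentially. (harm t :: real) > 2 / e"
    using harm_at_top by (rule filterlim_at_top_dense[THEN iffD1, rule_format])
  then obtain t where t: "harm t > 2 / e" by (auto dest: eventually_happens)
  have "\<exists>P. L t = 2 ^ multiplicity 2 (L t) * P \<and> odd P"
    using multiplicity_decompose'[of "L t" 2] L_pos[of t] by (metis mult.commute not_prime_unit two_is_prime_nat less_irrefl)
  then obtain a P where P: "L t = 2 ^ a * P" "odd P" by blast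
  have "totient_density (L t) * harm t \<le> 1"
    by (rule totient_density_le_inverse_harm[OF L_pos dvd_L])
  moreover have P_le: "totient_density P \<le> 2 * totient_density (L t)"
  proof -
    have "P > 0" using P(2) by (cases P) auto
    have "coprime (2 ^ a) P" using P(2) by (simp add: coprime_commute)
    then have "totient (L t) = totient (2 ^ a) * totient P"
      by (simp add: P totient_mult_coprime)
    \<comment> \<open>This is an equality for \<open>a > 0\<close>; for \<open>a = 0\<close> it
      reads \<open>1 \<le> 2\<close>.\<close>
    moreover have le: "2 ^ a \<le> 2 * totient (2 ^ a)"
    proof (cases a)
      case (Suc b)
      then show ?thesis using totient_prime_power_Suc[of 2 b] by simp
    qed simp
    have "real (2 ^ a * totient P) \<le> real (2 * totient (2 ^ a) * totient P)"
      unfolding of_nat_le_iff by (rule mult_right_mono[OF le]) simp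
    ultimately show ?thesis
      using \<open>P > 0\<close> by (simp add: totient_density_def P(1) field_simps)
  qed
  moreover have h: "(harm t :: real) > 0"
    using less_trans[OF _ t, of 0] assms by simp
  ultimately have "totient_density P * harm t \<le> 2"
    using mult_right_mono[OF P_le less_imp_le[OF h]] by linarith
  also have "2 < e * harm t" using t assms by (simp add: field_simps)
  finally have "totient_density P < e" using h by (simp only: mult_less_cancel_right_pos)
  with P(2) show thesis by (rule that)
qed

theorem theorem4p1:
  "(\<forall>q::nat. primepow q \<longrightarrow>
      convergent (A q) \<and> rho_bar q > 0 \<and>
      ((\<lambda>x::real. (1 / x) * (\<Sum>n | n \<ge> 1 \<and> real n \<le> x. rho q n)) \<longlongrightarrow> rho_bar q) at_top) \<and>
   Liminf primepow_at_top (\<lambda>q. ereal (rho_bar q)) = 0"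
proof
  show main: "\<forall>q::nat. primepow q \<longrightarrow>
      convergent (A q) \<and> rho_bar q > 0 \<and>
      ((\<lambda>x::real. (1 / x) * (\<Sum>n | n \<ge> 1 \<and> real n \<le> x. rho q n)) \<longlongrightarrow> rho_bar q) at_top"
  proof (intro allI impI)
    fix q :: nat assume "primepow q"
    then have "q \<ge> 2" using primepow_gt_Suc_0[of q] by simp
    then obtain l where l: "l > 0" "A q \<longlonglongrightarrow> l" "(\<lambda>N. (\<Sum>n\<in>{1..N}. rho q n) / real N) \<longlonglongrightarrow> l"
      using mean_limits by blast
    moreover have "rho_bar q = l" using l(2) by (simp add: rho_bar_def limI)
    ultimately show "convergent (A q) \<and> rho_bar q > 0 \<and>
      ((\<lambda>x::real. (1 / x) * (\<Sum>n | n \<ge> 1 \<and> real n \<le> x. rho q n)) \<longlongrightarrow> rho_bar q) at_top"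
      using sum_upto_real_mean_tendsto[OF l(3)] by (simp add: convergentI)
  qed
  have small: "\<exists>q\<ge>m. primepow q \<and> rho_bar q \<le> e" if e: "e > 0" for m e
  proof -
    obtain P where P: "odd P" "totient_density P < e"
      using exists_odd_small_totient_density[OF e] .
    have "P > 0" using P(1) by (cases P) auto
    \<comment> \<open>The factor \<open>totient P\<close> serves Euler's theorem modulo
      \<open>P\<close>; \<open>Suc m\<close> forces \<open>q \<ge> m\<close>.\<close>
    define q :: nat where "q = 2 ^ (totient P * Suc m)"
    have tot: "totient P * Suc m > 0" using \<open>P > 0\<close> by simp
    have "1 * Suc m \<le> totient P * Suc m"
      using \<open>P > 0\<close> by (intro mult_le_mono1) (simp add: Suc_leI)
    also have "\<dots> < q" unfolding q_def by (rule less_exp)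
    finally have qm: "q \<ge> 2" "q \<ge> m" by auto
    have "primepow q" unfolding q_def primepow_def using tot two_is_prime_nat by blast
    have "[2 ^ totient P = 1] (mod P)"
      using P(1) by (intro euler_theorem) (simp add: coprime_commute)
    then have "[(2 ^ totient P) ^ (Suc m * n) = 1 ^ (Suc m * n)] (mod P)" for n
      by (rule cong_pow)
    then have "[q ^ n = 1] (mod P)" for n
      by (simp only: q_def power_mult[symmetric] power_one mult.assoc)
    then have dvd: "P dvd q ^ n - 1" for n
      using qm by (simp add: cong_altdef_nat)
    \<comment> \<open>A multiple of \<open>P\<close> has at most the totient density of
      \<open>P\<close>, so the bound is the same for all \<open>n\<close>.\<close>
    have le: "primitive_density q n \<le> e" if "n > 0" for n
      using totient_density_decrease(1)[OF dvd power_minus_1_pos[OF qm(1) that]] P(2)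
      by (simp add: primitive_density_def)
    obtain l where l: "A q \<longlonglongrightarrow> l" "(\<lambda>N. (\<Sum>n\<in>{1..N}. primitive_density q n) / real N) \<longlonglongrightarrow> l"
      using mean_limits[OF qm(1)] by blast
    have "(\<Sum>n\<in>{1..N}. primitive_density q n) / real N \<le> e" for N
    proof -
      have "(\<Sum>n\<in>{1..N}. primitive_density q n) \<le> (\<Sum>n\<in>{1..N}. e)"
        using le by (intro sum_mono) auto
      then show ?thesis using e by (cases "N = 0") (auto simp: field_simps)
    qed
    then have "l \<le> e" using l(2) by (intro LIMSEQ_le_const2) auto
    moreover have "rho_bar q = l" using l(1) by (simp add: rho_bar_def limI)
    ultimately show ?thesis using qm \<open>primepow q\<close> by blast
  qed
  show "Liminf primepow_at_top (\<lambda>q. ereal (rho_bar q)) = 0"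
  proof (rule antisym)
    show "0 \<le> Liminf primepow_at_top (\<lambda>q. ereal (rho_bar q))"
      using main by (intro Liminf_bounded)
        (auto simp: primepow_at_top_def eventually_inf_principal less_imp_le intro!: always_eventually)
    show "Liminf primepow_at_top (\<lambda>q. ereal (rho_bar q)) \<le> 0"
    proof (rule ccontr)
      assume "\<not> ?thesis"
      \<comment> \<open>A real \<open>e\<close> strictly between 0 and the lower limit would
        eventually lie below \<open>rho_bar\<close> on prime powers, against
        \<open>small\<close>.\<close>
      then obtain e where e: "0 < ereal e" "ereal e < Liminf primepow_at_top (\<lambda>q. ereal (rho_bar q))"
        using ereal_dense2[of 0] by (auto simp: not_le)
      then have "\<forall>\<^sub>F q in primepow_at_top. ereal e < ereal (rho_bar q)"
        by (intro less_LiminfD)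
      then obtain m where "\<forall>q\<ge>m. primepow q \<longrightarrow> e < rho_bar q"
        by (auto simp: primepow_at_top_def eventually_inf_principal eventually_at_top_linorder)
      then show False using small[of e m] e(1) by (auto simp: not_le[symmetric])
    qed
  qed
qed

end
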